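(* Let $X$ be a finite simple graph with adjacency matrix $A$, let $H(t)=\exp(iAt)$, and let $u$ and $v$ be distinct vertices of $X$. If there is perfect state transfer from $u$ to $v$ (that is, $|H(\tau)_{u,v}|=1$ for some real $\tau$), then $\Delta_u=\Delta_v$.
   Context: A partition $\pi$ of $V(X)$ into cells is equitable if for each ordered pair of cells $C_i,C_j$, all vertices in $C_i$ have the same number of neighbours in $C_j$. Given any partition of $V(X)$ there is a unique coarsest equitable partition refining it. For a vertex $w$, $\Delta_w$ denotes the coarsest equitable refinement of the partition $\{\{w\},V(X)\setminus\{w\}\}$. *)

theory Defs
  imports "HOL-Analysis.Analysis" "HOL-Library.Disjoint_Sets"
begin

text \<open>
  A finite simple graph is a symmetric irreflexive adjacency relation on a finite type \<open>'v\<close>,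
  whose elements are the vertices.
\<close>

definition simple_graph :: "('v::finite \<Rightarrow> 'v \<Rightarrow> bool) \<Rightarrow> bool" where
  "simple_graph E \<longleftrightarrow> symp E \<and> irreflp E"

definition adjacency_matrix :: "('v::finite \<Rightarrow> 'v \<Rightarrow> bool) \<Rightarrow> complex^'v^'v" where
  "adjacency_matrix E = (\<chi> x y. of_bool (E x y))"

text \<open>
  The type of square matrices is not an instance of \<^class>\<open>real_normed_algebra_1\<close>, so
  \<^const>\<open>exp\<close> is not available for it. Its operation \<open>(*)\<close> is moreover entrywise, which is why
  the powers below are iterates of \<open>(**)\<close>.
\<close>

definition matrix_exp :: "complex^'n^'n \<Rightarrow> complex^'n^'n" where
  "matrix_exp M = (\<Sum>k. (((**) M ^^ k) (mat 1)) /\<^sub>R fact k)"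

definition transition_matrix :: "('v::finite \<Rightarrow> 'v \<Rightarrow> bool) \<Rightarrow> real \<Rightarrow> complex^'v^'v" where
  "transition_matrix E t = matrix_exp (\<chi> x y. \<i> * adjacency_matrix E $ x $ y * of_real t)"

definition perfect_state_transfer :: "('v::finite \<Rightarrow> 'v \<Rightarrow> bool) \<Rightarrow> 'v \<Rightarrow> 'v \<Rightarrow> bool" where
  "perfect_state_transfer E u v \<longleftrightarrow> (\<exists>\<tau>::real. norm (transition_matrix E \<tau> $ u $ v) = 1)"

definition equitable_partition :: "('v::finite \<Rightarrow> 'v \<Rightarrow> bool) \<Rightarrow> 'v set set \<Rightarrow> bool" where
  "equitable_partition E P \<longleftrightarrow> partition_on UNIV P \<and>
     (\<forall>C\<in>P. \<forall>D\<in>P. \<forall>x\<in>C. \<forall>y\<in>C. card {z \<in> D. E x z} = card {z \<in> D. E y z})"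

definition is_coarsest_equitable_refinement ::
    "('v::finite \<Rightarrow> 'v \<Rightarrow> bool) \<Rightarrow> 'v set set \<Rightarrow> 'v set set \<Rightarrow> bool" where
  "is_coarsest_equitable_refinement E P Q \<longleftrightarrow>
     equitable_partition E Q \<and> refines UNIV Q P \<and>
     (\<forall>R. equitable_partition E R \<and> refines UNIV R P \<longrightarrow> refines UNIV R Q)"

text \<open>Existence and uniqueness are shown at the end of this theory.\<close>

definition coarsest_equitable_refinement ::
    "('v::finite \<Rightarrow> 'v \<Rightarrow> bool) \<Rightarrow> 'v set set \<Rightarrow> 'v set set" where
  "coarsest_equitable_refinement E P = (THE Q. is_coarsest_equitable_refinement E P Q)"

text \<open>
  Cells are nonempty, so the empty set has to be dropped when \<open>w\<close> is the only vertex.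
\<close>

definition vertex_partition :: "'v::finite \<Rightarrow> 'v set set" where
  "vertex_partition w = {{w}, UNIV - {w}} - {{}}"

definition Delta :: "('v::finite \<Rightarrow> 'v \<Rightarrow> bool) \<Rightarrow> 'v \<Rightarrow> 'v set set" where
  "Delta E w = coarsest_equitable_refinement E (vertex_partition w)"

lemma partition_on_vertex_partition: "partition_on UNIV (vertex_partition w)"
  by (auto simp: vertex_partition_def partition_on_def disjoint_def)

lemma card_split_cells:
  fixes Q :: "'v::finite set set"
  assumes Q: "partition_on UNIV Q" and C: "\<And>D. D \<in> Q \<Longrightarrow> D \<subseteq> C \<or> D \<inter> C = {}"
  shows "card {z \<in> C. p z} = (\<Sum>D\<in>{D\<in>Q. D \<subseteq> C}. card {z \<in> D. p z})"
proof -
  have "{z \<in> C. p z} = (\<Union>D\<in>{D\<in>Q. D \<subseteq> C}. {z \<in> D. p z})"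
  proof (intro equalityI subsetI)
    fix z assume z: "z \<in> {z \<in> C. p z}"
    obtain D where "D \<in> Q" "z \<in> D"
      using partition_onD1[OF Q] by blast
    then show "z \<in> (\<Union>D\<in>{D\<in>Q. D \<subseteq> C}. {z \<in> D. p z})"
      using z C[of D] by blast
  qed auto
  also have "card \<dots> = (\<Sum>D\<in>{D\<in>Q. D \<subseteq> C}. card {z \<in> D. p z})"
    using partition_onD2[OF Q] by (intro card_UN_disjoint) (auto simp: disjoint_def)
  finally show ?thesis .
qed

text \<open>The join of all equitable refinements of \<open>P\<close> is again an equitable refinement of \<open>P\<close>.\<close>

lemma ex_coarsest_equitable_refinement:
  fixes E :: "'v::finite \<Rightarrow> 'v \<Rightarrow> bool"
  assumes P: "partition_on UNIV P"
  shows "\<exists>Q. is_coarsest_equitable_refinement E P Q"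
proof -
  define QQ where "QQ = {Q. equitable_partition E Q \<and> refines UNIV Q P}"
  define S where "S = {(x, y). \<exists>Q\<in>QQ. \<exists>D\<in>Q. x \<in> D \<and> y \<in> D}"
  define J where "J = UNIV // S\<^sup>*"
  have "sym S" by (auto simp: S_def sym_def)
  then have eqv: "equiv UNIV (S\<^sup>*)"
    by (intro equivI) (auto simp: sym_rtrancl trans_rtrancl refl_rtrancl)
  have J: "partition_on UNIV J"
    unfolding J_def by (rule partition_on_quotient[OF eqv])
  have closed: "y \<in> C" if "C \<in> J" "x \<in> C" "(x, y) \<in> S" for C x y
  proof -
    obtain a where a: "C = S\<^sup>* `` {a}" using \<open>C \<in> J\<close> by (auto simp: J_def elim: quotientE)
    then have "(a, x) \<in> S\<^sup>*" using \<open>x \<in> C\<close> by simp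
    then show ?thesis using a \<open>(x, y) \<in> S\<close> by (simp add: rtrancl.rtrancl_into_rtrancl)
  qed
  have QJ: "refines UNIV Q J" if "Q \<in> QQ" for Q
    unfolding refines_def
  proof (intro conjI ballI)
    show Qp: "partition_on UNIV Q" using that by (auto simp: QQ_def equitable_partition_def)
    fix D assume D: "D \<in> Q"
    then obtain x where x: "x \<in> D" using partition_onD3[OF Qp] by (metis all_not_in_conv)
    obtain C where C: "C \<in> J" "x \<in> C" using partition_onD1[OF J] by blast
    have "D \<subseteq> C" using closed[OF C] D x that by (auto simp: S_def)
    then show "\<exists>Y\<in>J. D \<subseteq> Y" using C by blast
  qed (rule J)
  have cell_step: "card {z \<in> C. E x z} = card {z \<in> C. E y z}" if C: "C \<in> J" and xy: "(x, y) \<in> S" for C x y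
  proof -
    obtain Q D where Q: "Q \<in> QQ" and D: "D \<in> Q" "x \<in> D" "y \<in> D" using xy by (auto simp: S_def)
    have Qp: "partition_on UNIV Q" using Q by (auto simp: QQ_def equitable_partition_def)
    have sub: "B \<subseteq> C \<or> B \<inter> C = {}" if "B \<in> Q" for B
    proof -
      have "(b, b') \<in> S" if "b \<in> B" "b' \<in> B" for b b'
        using that \<open>B \<in> Q\<close> Q by (auto simp: S_def)
      then show ?thesis using closed[OF C] by blast
    qed
    have "\<forall>C\<in>Q. \<forall>D\<in>Q. \<forall>x\<in>C. \<forall>y\<in>C. card {z \<in> D. E x z} = card {z \<in> D. E y z}"
      using Q unfolding QQ_def equitable_partition_def by blast
    then have cell: "card {z \<in> B. E x z} = card {z \<in> B. E y z}" if "B \<in> Q" for B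
      using D that by meson
    have "card {z \<in> C. E x z} = (\<Sum>B\<in>{B\<in>Q. B \<subseteq> C}. card {z \<in> B. E x z})"
      by (rule card_split_cells[OF Qp sub])
    also have "\<dots> = (\<Sum>B\<in>{B\<in>Q. B \<subseteq> C}. card {z \<in> B. E y z})"
      by (rule sum.cong[OF refl]) (rule cell, elim CollectE conjE)
    also have "\<dots> = card {z \<in> C. E y z}"
      by (rule card_split_cells[OF Qp sub, symmetric])
    finally show ?thesis .
  qed
  have steps: "card {z \<in> C. E x z} = card {z \<in> C. E y z}" if "C \<in> J" "(x, y) \<in> S\<^sup>*" for C x y
    using that(2)
  proof (induction rule: rtrancl_induct)
    case (step y z)
    then show ?case using cell_step[OF that(1), of y z] by (metis (no_types, lifting))
  qed simp
  have "equitable_partition E J"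
    unfolding equitable_partition_def
  proof (intro conjI ballI J)
    fix C D x y assume "C \<in> J" "D \<in> J" "x \<in> C" "y \<in> C"
    then have "(x, y) \<in> S\<^sup>*" using in_quotient_imp_in_rel[OF eqv, of C x y] by (simp add: J_def)
    then show "card {z \<in> D. E x z} = card {z \<in> D. E y z}" by (rule steps[OF \<open>D \<in> J\<close>])
  qed
  moreover have "refines UNIV J P"
    unfolding refines_def
  proof (intro conjI ballI)
    fix C assume C: "C \<in> J"
    then obtain x where x: "C = S\<^sup>* `` {x}" by (auto simp: J_def elim: quotientE)
    obtain B where B: "B \<in> P" "x \<in> B" using partition_onD1[OF P] by blast
    have st: "z \<in> B" if yB: "y \<in> B" and yz: "(y, z) \<in> S" for y z
    proof -
      obtain Q D where Q: "Q \<in> QQ" and D: "D \<in> Q" "y \<in> D" "z \<in> D" using yz by (auto simp: S_def)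
      obtain B' where B': "B' \<in> P" "D \<subseteq> B'" using Q D by (auto simp: QQ_def refines_def)
      then have "B' = B" using partition_onD2[OF P] B yB D unfolding disjoint_def by blast
      then show ?thesis using B' D by blast
    qed
    have "y \<in> B" if "(x, y) \<in> S\<^sup>*" for y
      using that by (induction rule: rtrancl_induct) (use B st in auto)
    then show "\<exists>Y\<in>P. C \<subseteq> Y" using B x by blast
  qed (use J P in auto)
  ultimately have "is_coarsest_equitable_refinement E P J"
    using QJ by (auto simp: is_coarsest_equitable_refinement_def QQ_def)
  then show ?thesis by blast
qed

lemma ex1_coarsest_equitable_refinement:
  assumes "partition_on UNIV P"
  shows "\<exists>!Q. is_coarsest_equitable_refinement E P Q"
proof (rule ex_ex1I[OF ex_coarsest_equitable_refinement[OF assms]])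
  fix Q R assume "is_coarsest_equitable_refinement E P Q" "is_coarsest_equitable_refinement E P R"
  then show "Q = R"
    by (intro refines_asym) (auto simp: is_coarsest_equitable_refinement_def)
qed

lemma is_coarsest_equitable_refinement_Delta:
  "is_coarsest_equitable_refinement E (vertex_partition w) (Delta E w)"
  unfolding Delta_def coarsest_equitable_refinement_def
  by (rule theI', rule ex1_coarsest_equitable_refinement, rule partition_on_vertex_partition)

text \<open>The series defining \<^const>\<open>matrix_exp\<close> converges for every matrix.\<close>

lemma summable_matrix_exp:
  fixes M :: "complex^'n^'n"
  shows "summable (\<lambda>k. (((**) M ^^ k) (mat 1)) /\<^sub>R fact k)"
proof -
  define K where "K = real CARD('n) * (\<Sum>i\<in>UNIV. \<Sum>j\<in>UNIV. norm (M $ i $ j))"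
  have entry: "norm (M $ i $ j) \<le> (\<Sum>i\<in>UNIV. \<Sum>j\<in>UNIV. norm (M $ i $ j))" for i j
  proof -
    have "norm (M $ i $ j) \<le> (\<Sum>j\<in>UNIV. norm (M $ i $ j))"
      by (rule member_le_sum) auto
    also have "\<dots> \<le> (\<Sum>i\<in>UNIV. \<Sum>j\<in>UNIV. norm (M $ i $ j))"
      by (rule member_le_sum[where f = "\<lambda>i. \<Sum>j\<in>UNIV. norm (M $ i $ j)"]) (auto intro: sum_nonneg)
    finally show ?thesis .
  qed
  have pow: "norm ((((**) M ^^ k) (mat 1)) $ i $ j) \<le> K ^ k" for k i j
  proof (induction k arbitrary: i j)
    case 0
    then show ?case by (simp add: mat_def)
  next
    case (Suc k)
    have "norm ((((**) M ^^ Suc k) (mat 1)) $ i $ j)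
        \<le> (\<Sum>l\<in>UNIV. norm (M $ i $ l) * norm ((((**) M ^^ k) (mat 1)) $ l $ j))"
      by (simp add: matrix_matrix_mult_def flip: norm_mult) (rule norm_sum)
    also have "\<dots> \<le> (\<Sum>l\<in>(UNIV::'n set). (\<Sum>i\<in>UNIV. \<Sum>j\<in>UNIV. norm (M $ i $ j)) * K ^ k)"
      by (intro sum_mono mult_mono entry Suc sum_nonneg) auto
    also have "\<dots> = K ^ Suc k" by (simp add: K_def)
    finally show ?case .
  qed
  have "summable (\<lambda>k. inverse (fact k) * K ^ k)" by (rule summable_exp)
  then have "summable (\<lambda>k. real CARD('n) * (real CARD('n) * (inverse (fact k) * K ^ k)))"
    by (intro summable_mult)
  then show ?thesis
  proof (rule summable_comparison_test')
    fix k
    have "norm ((((**) M ^^ k) (mat 1))) \<le> (\<Sum>i\<in>UNIV. norm ((((**) M ^^ k) (mat 1)) $ i))"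
      by (simp add: norm_vec_def L2_set_le_sum)
    also have "\<dots> \<le> (\<Sum>i\<in>UNIV. \<Sum>j\<in>UNIV. norm ((((**) M ^^ k) (mat 1)) $ i $ j))"
      by (intro sum_mono) (simp add: norm_vec_def L2_set_le_sum)
    also have "\<dots> \<le> (\<Sum>i\<in>(UNIV::'n set). \<Sum>j\<in>(UNIV::'n set). K ^ k)"
      by (intro sum_mono pow)
    finally have "norm ((((**) M ^^ k) (mat 1))) \<le> real CARD('n) * (real CARD('n) * K ^ k)" by simp
    then show "norm ((((**) M ^^ k) (mat 1)) /\<^sub>R fact k)
        \<le> real CARD('n) * (real CARD('n) * (inverse (fact k) * K ^ k))"
      by (simp add: field_simps)
  qed
qed

end

theory Submission
  imports Defs
begin

text \<open>
  The vectors that are constant on the cells of an equitable partition form a subspace invariant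
  under \<open>A\<close>, hence under \<open>H(\<tau>)\<close>. For \<open>\<Delta>\<^sub>u\<close> it contains \<open>e\<^sub>u\<close>, so it
  contains \<open>H(\<tau>) e\<^sub>u\<close>, which by unitarity is a multiple of \<open>e\<^sub>v\<close>. Hence \<open>{v}\<close> is a
  cell of \<open>\<Delta>\<^sub>u\<close>, that is, \<open>\<Delta>\<^sub>u\<close> refines \<open>\<Delta>\<^sub>v\<close>. Since \<open>H(\<tau>)\<close> is symmetric, the
  roles of \<open>u\<close> and \<open>v\<close> can be exchanged.
\<close>

text \<open>This is the form in which powers occur in \<open>matrix_exp\<close>, so facts about it
  apply to the series directly.\<close>

abbreviation matrix_power :: "'a::comm_semiring_1^'n^'n \<Rightarrow> nat \<Rightarrow> 'a^'n^'n" where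
  "matrix_power M k \<equiv> ((**) M ^^ k) (mat 1)"

lemma matrix_iterate_mult: "((**) M ^^ k) N = matrix_power M k ** N"
  by (induction k) (simp_all add: matrix_mul_assoc)

lemma matrix_power_add: "matrix_power M (k + l) = matrix_power M k ** matrix_power M l"
  by (simp add: funpow_add matrix_iterate_mult[of k M "matrix_power M l"])

lemma transpose_matrix_power:
  assumes "transpose M = M"
  shows "transpose (matrix_power M k) = matrix_power M k"
proof (induction k)
  case 0
  then show ?case by (simp add: transpose_mat)
next
  case (Suc k)
  have "transpose (matrix_power M (Suc k)) = matrix_power M k ** M"
    by (simp add: matrix_transpose_mul Suc assms)
  \<comment> \<open>Transposition reverses the product; \<open>M\<close> commutes with its powers,
    which restores the order.\<close>
  also have "\<dots> = matrix_power M (Suc k)"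
    using matrix_power_add[of k 1 M] by simp
  finally show ?case .
qed

lemma matrix_power_symmetric:
  assumes "transpose M = M"
  shows "matrix_power M k $ x $ y = matrix_power M k $ y $ x"
  by (subst transpose_matrix_power[OF assms, symmetric]) (simp add: transpose_def)

text \<open>Serves to pull the scalar i t out of the powers of i t A, so that only powers of A
  remain.\<close>

lemma matrix_power_scale:
  "matrix_power (\<chi> x y. c * M $ x $ y) k $ x $ y = c ^ k * matrix_power M k $ x $ y"
  by (induction k arbitrary: x y)
    (simp_all add: matrix_matrix_mult_def mat_def sum_distrib_left mult_ac)

lemma cnj_matrix_power:
  assumes "\<And>x y. cnj (M $ x $ y) = M $ x $ y"
  shows "cnj (matrix_power M k $ x $ y) = matrix_power M k $ x $ y"
  by (induction k arbitrary: x y) (simp_all add: matrix_matrix_mult_def mat_def assms)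

lemma transpose_adjacency_matrix:
  "simple_graph E \<Longrightarrow> transpose (adjacency_matrix E) = adjacency_matrix E"
  by (auto simp: simple_graph_def adjacency_matrix_def transpose_def vec_eq_iff symp_def)

lemma matrix_exp_sums:
  "(\<lambda>k. matrix_power M k $ x $ y /\<^sub>R fact k) sums (matrix_exp M $ x $ y)"
proof -
  have "(\<lambda>k. matrix_power M k /\<^sub>R fact k) sums matrix_exp M"
    unfolding matrix_exp_def by (rule summable_sums[OF summable_matrix_exp])
  from bounded_linear.sums[OF bounded_linear_vec_nth, OF bounded_linear.sums[OF bounded_linear_vec_nth, OF this]]
  show ?thesis by simp
qed

text \<open>With the factor t^k split off, each entry of H(t) is a power series in t, to which
  results on the disc of convergence apply.\<close>

lemma transition_matrix_sums:
  "(\<lambda>k. matrix_power (adjacency_matrix E) k $ x $ y * \<i> ^ k / fact k * of_real t ^ k)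
     sums (transition_matrix E t $ x $ y)"
proof -
  have "(\<chi> x y. \<i> * adjacency_matrix E $ x $ y * of_real t)
      = (\<chi> x y. (\<i> * of_real t) * adjacency_matrix E $ x $ y)"
    by (simp add: mult_ac)
  then have "(\<lambda>k. ((\<i> * of_real t) ^ k * matrix_power (adjacency_matrix E) k $ x $ y) /\<^sub>R fact k)
      sums (transition_matrix E t $ x $ y)"
    using matrix_exp_sums[of "\<chi> x y. (\<i> * of_real t) * adjacency_matrix E $ x $ y" x y]
    by (simp only: transition_matrix_def matrix_power_scale)
  then show ?thesis
    by (simp add: power_mult_distrib scaleR_conv_of_real divide_inverse mult_ac)
qed

text \<open>A power series converges absolutely at points of smaller modulus than a point of
  convergence. The series converges at every real point, in particular at
  \<open>\<bar>t\<bar> + 1\<close>, which exceeds the modulus of t.\<close>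

lemma transition_matrix_summable_norm:
  "summable (\<lambda>k. norm (matrix_power (adjacency_matrix E) k $ x $ y * \<i> ^ k / fact k * of_real t ^ k))"
proof (rule powser_insidea)
  show "summable (\<lambda>k. matrix_power (adjacency_matrix E) k $ x $ y * \<i> ^ k / fact k
      * of_real (\<bar>t\<bar> + 1) ^ k)"
    by (rule sums_summable[OF transition_matrix_sums])
qed simp

lemma transition_matrix_symmetric:
  assumes "simple_graph E"
  shows "transition_matrix E t $ x $ y = transition_matrix E t $ y $ x"
proof -
  have "matrix_power (adjacency_matrix E) k $ x $ y = matrix_power (adjacency_matrix E) k $ y $ x" for k
    by (rule matrix_power_symmetric[OF transpose_adjacency_matrix[OF assms]])
  then show ?thesis
    by (intro sums_unique2[OF transition_matrix_sums[of E x y t]]) (simp only: transition_matrix_sums)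
qed

text \<open>This is the part of unitarity that is needed. Each entry is multiplied by its conjugate
  as a Cauchy product of series; summed over the column, the coefficients of positive degree cancel
  by the binomial theorem.\<close>

lemma transition_matrix_column_norm:
  assumes "simple_graph E"
  shows "(\<Sum>x\<in>UNIV. (norm (transition_matrix E t $ x $ w))\<^sup>2) = 1"
proof -
  define P where "P = matrix_power (adjacency_matrix E)"
  define a where "a x k = P k $ x $ w * \<i> ^ k / fact k * of_real t ^ k" for x k
  have sym: "P k $ x $ y = P k $ y $ x" for k x y
    unfolding P_def by (rule matrix_power_symmetric[OF transpose_adjacency_matrix[OF assms]])
  have a: "a x sums (transition_matrix E t $ x $ w)" for x
    unfolding a_def P_def by (rule transition_matrix_sums)
  have na: "summable (\<lambda>k. norm (a x k))" for x
    unfolding a_def P_def by (rule transition_matrix_summable_norm)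
  \<comment> \<open>As A and t are real, conjugation only turns i into -i.\<close>
  have cnj_a: "cnj (a x k) = P k $ x $ w * (- \<i>) ^ k / fact k * of_real t ^ k" for x k
    by (simp add: a_def P_def cnj_matrix_power adjacency_matrix_def)
  have "(\<lambda>n. \<Sum>k\<le>n. a x k * cnj (a x (n - k))) sums of_real ((norm (transition_matrix E t $ x $ w))\<^sup>2)" for x
  proof -
    have "(\<lambda>n. \<Sum>k\<le>n. a x k * cnj (a x (n - k))) sums ((\<Sum>k. a x k) * (\<Sum>k. cnj (a x k)))"
      by (rule Cauchy_product_sums) (simp_all add: na)
    moreover have "(\<Sum>k. a x k) = transition_matrix E t $ x $ w"
      using a by (simp add: sums_iff)
    moreover have "(\<Sum>k. cnj (a x k)) = cnj (transition_matrix E t $ x $ w)"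
      using a[of x] sums_cnj[of "a x"] by (metis sums_unique)
    ultimately show ?thesis by (simp only: complex_norm_square)
  qed
  then have "(\<lambda>n. \<Sum>x\<in>UNIV. \<Sum>k\<le>n. a x k * cnj (a x (n - k))) sums
      (\<Sum>x\<in>UNIV. of_real ((norm (transition_matrix E t $ x $ w))\<^sup>2))"
    by (intro sums_sum)
  moreover have "(\<Sum>x\<in>UNIV. \<Sum>k\<le>n. a x k * cnj (a x (n - k))) = (if n = 0 then 1 else 0)" for n
  proof -
    have "(\<Sum>x\<in>UNIV. \<Sum>k\<le>n. a x k * cnj (a x (n - k)))
        = (\<Sum>k\<le>n. \<Sum>x\<in>UNIV. a x k * cnj (a x (n - k)))"
      by (rule sum.swap)
    also have "\<dots> = (\<Sum>k\<le>n. P n $ w $ w * of_real t ^ n / fact n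
        * (of_nat (n choose k) * \<i> ^ k * (- \<i>) ^ (n - k)))"
    proof (rule sum.cong[OF refl])
      fix k assume "k \<in> {..n}"
      then have k: "k \<le> n" by simp
      \<comment> \<open>By symmetry of A^k the sum is the diagonal entry at w of A^k A^(n-k), which
        does not depend on k.\<close>
      have "(\<Sum>x\<in>UNIV. P k $ x $ w * P (n - k) $ x $ w) = P n $ w $ w"
        using matrix_power_add[of k "n - k" "adjacency_matrix E"] k sym[of k w]
        by (simp add: P_def matrix_matrix_mult_def)
      moreover have "(\<Sum>x\<in>UNIV. a x k * cnj (a x (n - k)))
          = (\<Sum>x\<in>UNIV. P k $ x $ w * P (n - k) $ x $ w)
            * (\<i> ^ k * (- \<i>) ^ (n - k) / (fact k * fact (n - k)) * of_real t ^ (k + (n - k)))"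
        unfolding sum_distrib_right power_add cnj_a
        by (rule sum.cong[OF refl]) (simp add: a_def)
      ultimately show "(\<Sum>x\<in>UNIV. a x k * cnj (a x (n - k)))
          = P n $ w $ w * of_real t ^ n / fact n * (of_nat (n choose k) * \<i> ^ k * (- \<i>) ^ (n - k))"
        using k by (simp add: binomial_fact)
    qed
    \<comment> \<open>The binomial sum collapses to (i - i)^n = 0^n. Only n = 0 survives, with the
      value 1 because A^0 is the identity.\<close>
    also have "\<dots> = P n $ w $ w * of_real t ^ n / fact n * (\<i> + - \<i>) ^ n"
      by (simp only: binomial_ring flip: sum_distrib_left)
    also have "\<dots> = (if n = 0 then 1 else 0)"
      by (simp add: P_def mat_def)
    finally show ?thesis .
  qed
  ultimately have "(\<lambda>n. if n = 0 then 1 else 0) sums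
      (complex_of_real (\<Sum>x\<in>UNIV. (norm (transition_matrix E t $ x $ w))\<^sup>2))"
    by simp
  moreover have "(\<lambda>n. if n = 0 then 1 else 0) sums (1::complex)"
    using sums_single[of 0 "\<lambda>_. 1::complex"] by simp
  ultimately have "complex_of_real (\<Sum>x\<in>UNIV. (norm (transition_matrix E t $ x $ w))\<^sup>2) = 1"
    by (rule sums_unique2)
  then show ?thesis by (simp only: of_real_eq_1_iff)
qed

text \<open>Invariance under A of the vectors constant on cells: split by cells, the sum at a vertex
  is a combination of the values of \<open>f\<close> whose weights are the neighbour counts, and
  these agree for x and y.\<close>

lemma equitable_partition_sum_neighbours:
  fixes f :: "'v::finite \<Rightarrow> complex"
  assumes Q: "equitable_partition E Q" and C: "C \<in> Q" "x \<in> C" "y \<in> C"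
    and f: "\<And>D a b. D \<in> Q \<Longrightarrow> a \<in> D \<Longrightarrow> b \<in> D \<Longrightarrow> f a = f b"
  shows "(\<Sum>z\<in>UNIV. of_bool (E x z) * f z) = (\<Sum>z\<in>UNIV. of_bool (E y z) * f z)"
proof -
  have Qp: "partition_on UNIV Q"
    using Q by (simp add: equitable_partition_def)
  have split: "(\<Sum>z\<in>UNIV. g z) = (\<Sum>D\<in>Q. \<Sum>z\<in>D. g z)" for g :: "'v \<Rightarrow> complex"
    using sum.Union_disjoint_sets[of Q g] partition_onD1[OF Qp] partition_onD2[OF Qp] by simp
  have cell: "(\<Sum>z\<in>D. of_bool (E s z) * f z) = of_nat (card {z \<in> D. E s z}) * f d"
    if "D \<in> Q" "d \<in> D" for D d s
  proof -
    have "(\<Sum>z\<in>D. of_bool (E s z) * f z) = (\<Sum>z\<in>D. of_bool (E s z) * f d)"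
      by (rule sum.cong[OF refl]) (use f that in metis)
    then show ?thesis
      by (simp add: Collect_conj_eq flip: sum_distrib_right)
  qed
  show ?thesis
    unfolding split
  proof (rule sum.cong[OF refl])
    fix D assume D: "D \<in> Q"
    then obtain d where d: "d \<in> D"
      using partition_onD3[OF Qp] by (metis all_not_in_conv)
    have "card {z \<in> D. E x z} = card {z \<in> D. E y z}"
      using Q C D unfolding equitable_partition_def by meson
    then show "(\<Sum>z\<in>D. of_bool (E x z) * f z) = (\<Sum>z\<in>D. of_bool (E y z) * f z)"
      using cell[OF D d] by simp
  qed
qed

text \<open>Column u of A^k is A^k applied to the unit vector at u, so induction on k shows that it
  is constant on cells. The entries of H(t) at x and y then have the same series.\<close>

lemma transition_matrix_column_constant_on_cells:
  assumes Q: "equitable_partition E Q" and u: "{u} \<in> Q" and C: "C \<in> Q" "x \<in> C" "y \<in> C"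
  shows "transition_matrix E t $ x $ u = transition_matrix E t $ y $ u"
proof -
  have disj: "disjoint Q"
    using Q by (simp add: equitable_partition_def partition_on_def)
  have "matrix_power (adjacency_matrix E) k $ a $ u = matrix_power (adjacency_matrix E) k $ b $ u"
    if "D \<in> Q" "a \<in> D" "b \<in> D" for D a b k
    using that
  proof (induction k arbitrary: D a b)
    case 0
    \<comment> \<open>A cell that contains u is \<open>{u}\<close> itself, so the unit vector at u
      is constant on cells.\<close>
    then have "a = u \<longleftrightarrow> b = u"
      using disjointD[OF disj u, of D] by blast
    then show ?case by (simp add: mat_def)
  next
    case (Suc k)
    have "(\<Sum>z\<in>UNIV. of_bool (E a z) * matrix_power (adjacency_matrix E) k $ z $ u)
        = (\<Sum>z\<in>UNIV. of_bool (E b z) * matrix_power (adjacency_matrix E) k $ z $ u)"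
      by (rule equitable_partition_sum_neighbours[OF Q Suc.prems]) (rule Suc.IH)
    moreover have "matrix_power (adjacency_matrix E) (Suc k) $ c $ u
        = (\<Sum>z\<in>UNIV. of_bool (E c z) * matrix_power (adjacency_matrix E) k $ z $ u)" for c
      unfolding funpow.simps o_apply matrix_matrix_mult_def[of "adjacency_matrix E"]
      by (simp add: adjacency_matrix_def)
    ultimately show ?case by simp
  qed
  then have "matrix_power (adjacency_matrix E) k $ x $ u = matrix_power (adjacency_matrix E) k $ y $ u" for k
    using C by blast
  then show ?thesis
    by (intro sums_unique2[OF transition_matrix_sums[of E x u t]]) (simp only: transition_matrix_sums)
qed

text \<open>Reduces membership among the competitors of \<open>Delta E w\<close> to a statement
  about a single cell.\<close>

lemma refines_vertex_partition_iff:
  assumes Q: "partition_on UNIV Q"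
  shows "refines UNIV Q (vertex_partition w) \<longleftrightarrow> {w} \<in> Q"
proof
  assume "refines UNIV Q (vertex_partition w)"
  moreover obtain C where C: "C \<in> Q" "w \<in> C"
    using partition_onD1[OF Q] by blast
  ultimately obtain B where "B \<in> vertex_partition w" "C \<subseteq> B"
    by (auto simp: refines_def)
  then have "C = {w}"
    using C by (auto simp: vertex_partition_def)
  then show "{w} \<in> Q" using C by simp
next
  assume w: "{w} \<in> Q"
  have "\<exists>B\<in>vertex_partition w. C \<subseteq> B" if C: "C \<in> Q" for C
  proof (cases "C = {w}")
    case False
    then have "C \<subseteq> UNIV - {w}"
      using disjointD[OF partition_onD2[OF Q] C w] by blast
    \<comment> \<open>This makes \<open>UNIV - {w}\<close> nonempty and hence a member of
      \<open>vertex_partition w\<close>.\<close>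
    moreover have "C \<noteq> {}"
      using partition_onD3[OF Q] C by blast
    ultimately show ?thesis
      by (auto simp: vertex_partition_def)
  qed (auto simp: vertex_partition_def)
  then show "refines UNIV Q (vertex_partition w)"
    using Q by (simp add: refines_def partition_on_vertex_partition)
qed

text \<open>Column u of H(t) is constant on the cell of v, where its modulus is 1. A second vertex
  in that cell would raise the squared norm of the column to at least 2, so the cell is
  \<open>{v}\<close>.\<close>

lemma refines_Delta_of_transfer:
  assumes E: "simple_graph E" and "norm (transition_matrix E t $ v $ u) = 1"
  shows "refines UNIV (Delta E u) (Delta E v)"
proof -
  define Q where "Q = Delta E u"
  have Q: "equitable_partition E Q" "refines UNIV Q (vertex_partition u)"
    using is_coarsest_equitable_refinement_Delta[of E u]
    by (auto simp: Q_def is_coarsest_equitable_refinement_def)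
  have Qp: "partition_on UNIV Q"
    using Q by (simp add: equitable_partition_def)
  have u: "{u} \<in> Q"
    using Q refines_vertex_partition_iff[OF Qp] by simp
  obtain C where C: "C \<in> Q" "v \<in> C"
    using partition_onD1[OF Qp] by blast
  have "x = v" if x: "x \<in> C" for x
  proof (rule ccontr)
    assume "x \<noteq> v"
    have "norm (transition_matrix E t $ x $ u) = 1"
      using transition_matrix_column_constant_on_cells[OF Q(1) u C(1) x C(2), of t] assms(2) by simp
    then have "2 = (\<Sum>y\<in>{x, v}. (norm (transition_matrix E t $ y $ u))\<^sup>2)"
      using \<open>x \<noteq> v\<close> assms(2) by simp
    also have "\<dots> \<le> (\<Sum>y\<in>UNIV. (norm (transition_matrix E t $ y $ u))\<^sup>2)"
      by (rule sum_mono2) auto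
    finally show False
      using transition_matrix_column_norm[OF E, of t u] by simp
  qed
  then have "C = {v}" using C by blast
  then have "refines UNIV Q (vertex_partition v)"
    using C refines_vertex_partition_iff[OF Qp] by simp
  \<comment> \<open>\<open>Delta E u\<close> is now an equitable refinement of
    \<open>vertex_partition v\<close>, hence refines the coarsest one.\<close>
  then show ?thesis
    using is_coarsest_equitable_refinement_Delta[of E v] Q
    by (auto simp: Q_def is_coarsest_equitable_refinement_def)
qed

theorem theorem4p3:
  fixes E :: "'v::finite \<Rightarrow> 'v \<Rightarrow> bool" and u v :: 'v
  assumes "simple_graph E" and "u \<noteq> v"
    and "perfect_state_transfer E u v"
  shows "Delta E u = Delta E v"
proof -
  obtain \<tau> where \<tau>: "norm (transition_matrix E \<tau> $ u $ v) = 1"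
    using assms(3) by (auto simp: perfect_state_transfer_def)
  then have "norm (transition_matrix E \<tau> $ v $ u) = 1"
    by (simp add: transition_matrix_symmetric[OF assms(1), of \<tau> v u])
  from refines_asym[OF refines_Delta_of_transfer[OF assms(1) this]
      refines_Delta_of_transfer[OF assms(1) \<tau>]]
  show ?thesis .
qed

end
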